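(* Let $G$ be a group with finite generating set $S$, let $H$ be a subgroup of $G$ and let $g\in G$. Then the following are equivalent: (i) $g\in Comm(H,G)$; (ii) the Hausdorff distance $D_S(H,gH)$ is finite; (iii) the Hausdorff distance $D_S(H,gHg^{-1})$ is finite. In particular, for a subgroup $Q$ of a finitely generated group $G$, the following are equivalent: $Q$ is quasi-normal in $G$; the Hausdorff distance $D(Q,gQ)$ is finite for all $g\in G$; the Hausdorff distance $D(Q,gQg^{-1})$ is finite for all $g\in G$ (Hausdorff distances being taken with respect to a finite generating set of $G$).
   Context: For a subgroup $H$ of a group $G$, the commensurator of $H$ in $G$ is $Comm(H,G)=\{g\in G : gHg^{-1}\cap H \text{ has finite index in both } H \text{ and } gHg^{-1}\}$. A subgroup $Q$ of $G$ is quasi-normal in $G$ if $Comm(Q,G)=G$. For a finite generating set $S$ of $G$, let $\Gamma(G,S)$ be the Cayley graph (edges join $x$ to $xs$, so the edge path metric is invariant under left multiplication). For subsets $X,Y\subset G$, $D_S(X,Y)$ is the smallest integer $K$ such that every $x\in X$ is at edge path distance $\le K$ in $\Gamma(G,S)$ from some point of $Y$ and every $y\in Y$ is at edge path distance $\le K$ from some point of $X$; if no such $K$ exists, $D_S(X,Y)=\infty$. *)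

theory Defs
  imports "HOL-Algebra.Generated_Groups" "HOL-Library.Extended_Nat"
begin

definition conjugate :: "('a, 'b) monoid_scheme \<Rightarrow> 'a \<Rightarrow> 'a set \<Rightarrow> 'a set" where
  "conjugate G g H = (g <#\<^bsub>G\<^esub> H) #>\<^bsub>G\<^esub> (inv\<^bsub>G\<^esub> g)"

(* Both K and H are subgroups of G, with K contained in H; the cosets are those of K in H. *)
definition finite_index :: "('a, 'b) monoid_scheme \<Rightarrow> 'a set \<Rightarrow> 'a set \<Rightarrow> bool" where
  "finite_index G K H \<longleftrightarrow> finite (rcosets\<^bsub>G\<lparr>carrier := H\<rparr>\<^esub> K)"

definition commensurator :: "('a, 'b) monoid_scheme \<Rightarrow> 'a set \<Rightarrow> 'a set" where
  "commensurator G H =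
     {g \<in> carrier G. finite_index G (conjugate G g H \<inter> H) H \<and>
                      finite_index G (conjugate G g H \<inter> H) (conjugate G g H)}"

definition quasi_normal :: "('a, 'b) monoid_scheme \<Rightarrow> 'a set \<Rightarrow> bool" where
  "quasi_normal G Q \<longleftrightarrow> subgroup Q G \<and> commensurator G Q = carrier G"

(* Edges are undirected, so each one is recorded in both directions. *)
definition cayley_edges :: "('a, 'b) monoid_scheme \<Rightarrow> 'a set \<Rightarrow> ('a \<times> 'a) set" where
  "cayley_edges G S =
     {(x, y). x \<in> carrier G \<and> y \<in> carrier G \<and>
              (\<exists>s\<in>S. y = x \<otimes>\<^bsub>G\<^esub> s \<or> x = y \<otimes>\<^bsub>G\<^esub> s)}"

(* A pair lies in the n-th relational power of the edge relation iff an edge path with exactly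
   n edges joins its components; the infimum over an empty set is infinity. *)
definition path_dist :: "('a, 'b) monoid_scheme \<Rightarrow> 'a set \<Rightarrow> 'a \<Rightarrow> 'a \<Rightarrow> enat" where
  "path_dist G S x y = (INF n \<in> {n. (x, y) \<in> cayley_edges G S ^^ n}. enat n)"

definition hausdorff_bound ::
  "('a, 'b) monoid_scheme \<Rightarrow> 'a set \<Rightarrow> 'a set \<Rightarrow> 'a set \<Rightarrow> nat \<Rightarrow> bool" where
  "hausdorff_bound G S X Y K \<longleftrightarrow>
     (\<forall>x\<in>X. \<exists>y\<in>Y. path_dist G S x y \<le> enat K) \<and>
     (\<forall>y\<in>Y. \<exists>x\<in>X. path_dist G S y x \<le> enat K)"

definition hausdorff_dist ::
  "('a, 'b) monoid_scheme \<Rightarrow> 'a set \<Rightarrow> 'a set \<Rightarrow> 'a set \<Rightarrow> enat" where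
  "hausdorff_dist G S X Y =
     (if \<exists>K. hausdorff_bound G S X Y K then enat (LEAST K. hausdorff_bound G S X Y K) else \<infinity>)"

end

theory Submission
  imports Defs "HOL-Algebra.Group_Action"
begin

text \<open>
  Balls in the Cayley graph are finite and, \<open>S\<close> being a generating set, they exhaust the group.
  Hence \<open>X\<close> lies in a bounded neighbourhood of \<open>Y\<close> iff finitely many right translations suffice to
  move every point of \<open>X\<close> into \<open>Y\<close>. This relation is transitive and relates \<open>gH\<close> and
  \<open>gHg\<^sup>-\<^sup>1\<close> in both directions, by the single translations by \<open>g\<^sup>-\<^sup>1\<close> and \<open>g\<close>, so the two Hausdorff
  distances are finite simultaneously. For subgroups \<open>H\<close> and \<open>K\<close>, two elements of \<open>H\<close> that are
  moved into \<open>K\<close> by the same translation lie in the same right coset of \<open>H \<inter> K\<close>; so \<open>H\<close> lies in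
  a bounded neighbourhood of \<open>K\<close> iff \<open>H \<inter> K\<close> has finite index in \<open>H\<close>.
\<close>

text \<open>No generating set occurs here, so coset arguments can avoid paths. Translations act on
  the right because a path in the Cayley graph multiplies its starting point on the right.\<close>

definition coarsely_in :: "('a, 'b) monoid_scheme \<Rightarrow> 'a set \<Rightarrow> 'a set \<Rightarrow> bool" where
  "coarsely_in G X Y \<longleftrightarrow>
     (\<exists>F. finite F \<and> F \<subseteq> carrier G \<and> (\<forall>x\<in>X. \<exists>f\<in>F. x \<otimes>\<^bsub>G\<^esub> f \<in> Y))"

section \<open>Bounds on path and Hausdorff distances\<close>

lemma path_dist_le_iff:
  "path_dist G S x y \<le> enat K \<longleftrightarrow> (\<exists>n\<le>K. (x, y) \<in> cayley_edges G S ^^ n)" (is "?L \<longleftrightarrow> ?R")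
proof
  assume ?L
  \<comment> \<open>An infimum yields a witness only below a strict bound; integrality turns
    \<open>n < Suc K\<close> back into \<open>n \<le> K\<close>.\<close>
  then have "Inf (enat ` {n. (x, y) \<in> cayley_edges G S ^^ n}) < enat (Suc K)"
    unfolding path_dist_def by (simp add: order_le_less_trans)
  then obtain n where "(x, y) \<in> cayley_edges G S ^^ n" "enat n < enat (Suc K)"
    unfolding Inf_less_iff by blast
  then show ?R by (auto simp: less_Suc_eq_le)
next
  assume ?R
  then obtain n where n: "n \<le> K" "(x, y) \<in> cayley_edges G S ^^ n" by blast
  then have "path_dist G S x y \<le> enat n"
    unfolding path_dist_def by (intro INF_lower) simp
  also have "\<dots> \<le> enat K" using n by simp
  finally show ?L .
qed

lemma hausdorff_dist_finite_iff:
  "hausdorff_dist G S X Y < \<infinity> \<longleftrightarrow> (\<exists>K. hausdorff_bound G S X Y K)"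
  by (simp add: hausdorff_dist_def)

context group
begin

section \<open>Cayley paths as right translations\<close>

lemma cayley_edges_subset_translations:
  assumes "S \<subseteq> carrier G" and "(x, y) \<in> cayley_edges G S"
  shows "\<exists>t\<in>S \<union> m_inv G ` S. y = x \<otimes> t"
proof -
  have xy: "x \<in> carrier G" "y \<in> carrier G" using assms by (auto simp: cayley_edges_def)
  obtain s where s: "s \<in> S" "y = x \<otimes> s \<or> x = y \<otimes> s"
    using assms by (auto simp: cayley_edges_def)
  then have "s \<in> carrier G" using assms by blast
  then have "y = x \<otimes> s \<or> y = x \<otimes> inv s"
    using s xy by (auto simp: m_assoc)
  then show ?thesis using s by blast
qed

text \<open>Finiteness of balls, uniform in the centre: by left invariance a single \<open>F\<close>
  serves every \<open>x\<close>. Each further edge multiplies on the right by a generator or its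
  inverse.\<close>

lemma cayley_path_finite_translations:
  assumes "finite S" and "S \<subseteq> carrier G"
  shows "\<exists>F. finite F \<and> F \<subseteq> carrier G \<and>
    (\<forall>x\<in>carrier G. \<forall>y. (x, y) \<in> cayley_edges G S ^^ n \<longrightarrow> (\<exists>f\<in>F. y = x \<otimes> f))"
proof (induction n)
  case 0
  show ?case by (rule exI[of _ "{\<one>}"]) auto
next
  case (Suc n)
  then obtain F where F: "finite F" "F \<subseteq> carrier G"
    "\<And>x y. x \<in> carrier G \<Longrightarrow> (x, y) \<in> cayley_edges G S ^^ n \<Longrightarrow> \<exists>f\<in>F. y = x \<otimes> f"
    by blast
  define T where "T = S \<union> m_inv G ` S"
  have T: "finite T" "T \<subseteq> carrier G" using assms by (auto simp: T_def)
  show ?case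
  proof (intro exI[of _ "(\<lambda>(f, t). f \<otimes> t) ` (F \<times> T)"] conjI ballI allI impI)
    fix x z assume x: "x \<in> carrier G" and "(x, z) \<in> cayley_edges G S ^^ Suc n"
    then obtain y where "(x, y) \<in> cayley_edges G S ^^ n" "(y, z) \<in> cayley_edges G S" by auto
    then obtain f t where ft: "f \<in> F" "y = x \<otimes> f" "t \<in> T" "z = y \<otimes> t"
      using F(3)[OF x, of y] cayley_edges_subset_translations[OF assms(2), of y z, folded T_def]
      by metis
    then have "z = x \<otimes> (f \<otimes> t)" using F(2) T(2) x by (simp add: m_assoc subset_iff)
    with ft show "\<exists>f\<in>(\<lambda>(f, t). f \<otimes> t) ` (F \<times> T). z = x \<otimes> f" by force
  qed (use F T in auto)
qed

text \<open>The length depends on a word for \<open>f\<close> only, not on \<open>x\<close>. This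
  uniformity gives the common distance bound later.\<close>

lemma generate_cayley_path:
  assumes "S \<subseteq> carrier G" and "f \<in> generate G S"
  shows "\<exists>n. \<forall>x\<in>carrier G. (x, x \<otimes> f) \<in> cayley_edges G S ^^ n"
  using assms(2)
proof (induction rule: generate.induct)
  case one
  show ?case by (rule exI[of _ 0]) simp
next
  case (incl s)
  then show ?case using assms(1) by (intro exI[of _ 1]) (auto simp: cayley_edges_def)
next
  case (inv s)
  then have s: "s \<in> carrier G" using assms(1) by blast
  show ?case
  proof (intro exI[of _ 1] ballI)
    \<comment> \<open>The edge from \<open>x \<otimes> inv s\<close> to \<open>x\<close> given by
      \<open>s\<close> is traversed backwards.\<close>
    fix x assume "x \<in> carrier G"
    then show "(x, x \<otimes> inv s) \<in> cayley_edges G S ^^ 1"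
      using s inv by (auto simp: cayley_edges_def m_assoc intro!: bexI[of _ s])
  qed
next
  case (eng a b)
  then have ab: "a \<in> carrier G" "b \<in> carrier G"
    using generate_in_carrier[OF assms(1)] by auto
  obtain m n where mn: "\<And>x. x \<in> carrier G \<Longrightarrow> (x, x \<otimes> a) \<in> cayley_edges G S ^^ m"
    "\<And>x. x \<in> carrier G \<Longrightarrow> (x, x \<otimes> b) \<in> cayley_edges G S ^^ n"
    using eng.IH by blast
  show ?case
  proof (intro exI[of _ "m + n"] ballI)
    fix x assume x: "x \<in> carrier G"
    \<comment> \<open>Uniformity in the starting point lets the path for \<open>b\<close> start at
      \<open>x \<otimes> a\<close>.\<close>
    then have "(x, (x \<otimes> a) \<otimes> b) \<in> cayley_edges G S ^^ m O cayley_edges G S ^^ n"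
      using mn(1)[OF x] mn(2)[of "x \<otimes> a"] ab by blast
    then show "(x, x \<otimes> (a \<otimes> b)) \<in> cayley_edges G S ^^ (m + n)"
      using x ab by (simp add: relpow_add m_assoc)
  qed
qed

lemma coarsely_in_iff_path_dist_bounded:
  assumes "finite S" and "S \<subseteq> carrier G" and "generate G S = carrier G" and "X \<subseteq> carrier G"
  shows "coarsely_in G X Y \<longleftrightarrow> (\<exists>K. \<forall>x\<in>X. \<exists>y\<in>Y. path_dist G S x y \<le> enat K)"
    (is "?L \<longleftrightarrow> ?R")
proof
  assume ?L
  then obtain F where F: "finite F" "F \<subseteq> carrier G" "\<forall>x\<in>X. \<exists>f\<in>F. x \<otimes> f \<in> Y"
    by (auto simp: coarsely_in_def)
  have "\<forall>f\<in>F. \<exists>n. \<forall>x\<in>carrier G. (x, x \<otimes> f) \<in> cayley_edges G S ^^ n"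
    using generate_cayley_path[OF assms(2)] assms(3) F(2) by auto
  then obtain l where l: "\<forall>f\<in>F. \<forall>x\<in>carrier G. (x, x \<otimes> f) \<in> cayley_edges G S ^^ l f"
    by (auto dest: bchoice)
  \<comment> \<open>The sum serves as an upper bound for all \<open>l f\<close>; unlike a maximum it
    also makes sense for empty \<open>F\<close>.\<close>
  have "\<exists>y\<in>Y. path_dist G S x y \<le> enat (\<Sum>f\<in>F. l f)" if x: "x \<in> X" for x
  proof -
    obtain f where f: "f \<in> F" "x \<otimes> f \<in> Y" using F(3) x by blast
    moreover have "l f \<le> (\<Sum>f\<in>F. l f)" using F(1) f(1) by (intro member_le_sum) auto
    moreover have "(x, x \<otimes> f) \<in> cayley_edges G S ^^ l f" using l f(1) x assms(4) by auto
    ultimately show ?thesis unfolding path_dist_le_iff by metis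
  qed
  then show ?R by blast
next
  assume ?R
  then obtain K where K: "\<forall>x\<in>X. \<exists>y\<in>Y. \<exists>n\<le>K. (x, y) \<in> cayley_edges G S ^^ n"
    unfolding path_dist_le_iff by blast
  have "\<forall>n. \<exists>F. finite F \<and> F \<subseteq> carrier G \<and>
    (\<forall>x\<in>carrier G. \<forall>y. (x, y) \<in> cayley_edges G S ^^ n \<longrightarrow> (\<exists>f\<in>F. y = x \<otimes> f))"
    using cayley_path_finite_translations[OF assms(1,2)] by blast
  from choice[OF this] obtain B where B: "\<forall>n. finite (B n) \<and> B n \<subseteq> carrier G \<and>
    (\<forall>x\<in>carrier G. \<forall>y. (x, y) \<in> cayley_edges G S ^^ n \<longrightarrow> (\<exists>f\<in>B n. y = x \<otimes> f))"
    ..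
  have "\<exists>f\<in>\<Union>n\<le>K. B n. x \<otimes> f \<in> Y" if x: "x \<in> X" for x
  proof -
    obtain y n where y: "y \<in> Y" "n \<le> K" "(x, y) \<in> cayley_edges G S ^^ n" using K x by blast
    then obtain f where "f \<in> B n" "y = x \<otimes> f" using B x assms(4) by (meson subsetD)
    then show ?thesis using y by blast
  qed
  then show ?L unfolding coarsely_in_def
    using B by (intro exI[of _ "\<Union>n\<le>K. B n"]) auto
qed

lemma hausdorff_dist_finite_iff_coarsely_in:
  assumes "finite S" and "S \<subseteq> carrier G" and "generate G S = carrier G"
    and "X \<subseteq> carrier G" and "Y \<subseteq> carrier G"
  shows "hausdorff_dist G S X Y < \<infinity> \<longleftrightarrow> coarsely_in G X Y \<and> coarsely_in G Y X" (is "?L \<longleftrightarrow> ?R")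
proof
  assume ?L
  then show ?R
    unfolding hausdorff_dist_finite_iff hausdorff_bound_def
      coarsely_in_iff_path_dist_bounded[OF assms(1-3,4)]
      coarsely_in_iff_path_dist_bounded[OF assms(1-3,5)]
    by blast
next
  assume ?R
  then obtain K L where
    K: "\<forall>x\<in>X. \<exists>y\<in>Y. path_dist G S x y \<le> enat K" and
    L: "\<forall>y\<in>Y. \<exists>x\<in>X. path_dist G S y x \<le> enat L"
    unfolding coarsely_in_iff_path_dist_bounded[OF assms(1-3,4)]
      coarsely_in_iff_path_dist_bounded[OF assms(1-3,5)]
    by blast
  \<comment> \<open>The two directions come with separate bounds, while
    \<open>hausdorff_bound\<close> asks for a common one.\<close>
  have "enat K \<le> enat (max K L)" "enat L \<le> enat (max K L)" by simp_all
  then have "hausdorff_bound G S X Y (max K L)"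
    unfolding hausdorff_bound_def using K L order_trans by meson
  then show ?L unfolding hausdorff_dist_finite_iff by blast
qed

section \<open>Coarse containment of cosets and conjugates\<close>

lemma coarsely_in_trans:
  assumes "coarsely_in G X Y" and "coarsely_in G Y Z" and "X \<subseteq> carrier G"
  shows "coarsely_in G X Z"
proof -
  obtain E F where E: "finite E" "E \<subseteq> carrier G" "\<forall>x\<in>X. \<exists>e\<in>E. x \<otimes> e \<in> Y"
    and F: "finite F" "F \<subseteq> carrier G" "\<forall>y\<in>Y. \<exists>f\<in>F. y \<otimes> f \<in> Z"
    using assms by (auto simp: coarsely_in_def)
  have "\<exists>d\<in>(\<lambda>(e, f). e \<otimes> f) ` (E \<times> F). x \<otimes> d \<in> Z" if x: "x \<in> X" for x
  proof -
    obtain e f where ef: "e \<in> E" "f \<in> F" "(x \<otimes> e) \<otimes> f \<in> Z" using E F x by blast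
    then have "x \<otimes> (e \<otimes> f) \<in> Z" using E F x assms(3) by (metis m_assoc subsetD)
    then show ?thesis using ef by force
  qed
  then show ?thesis unfolding coarsely_in_def
    using E F by (intro exI[of _ "(\<lambda>(e, f). e \<otimes> f) ` (E \<times> F)"]) auto
qed

lemma conjugate_eq_image:
  "conjugate G g H = (\<lambda>h. g \<otimes> h \<otimes> inv g) ` H"
  by (auto simp: conjugate_def l_coset_def r_coset_def)

lemma conjugate_subgroup:
  assumes "subgroup H G" and "g \<in> carrier G"
  shows "subgroup (conjugate G g H) G"
  using subgroup_conjugation_is_surj1[of "inv g" H] assms by (simp add: conjugate_def)

lemma coarsely_in_l_coset_conjugate:
  assumes "g \<in> carrier G"
  shows "coarsely_in G (g <# H) (conjugate G g H)"
  unfolding coarsely_in_def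
  by (rule exI[of _ "{inv g}"]) (use assms in \<open>auto simp: conjugate_def r_coset_def\<close>)

lemma coarsely_in_conjugate_l_coset:
  assumes "H \<subseteq> carrier G" and "g \<in> carrier G"
  shows "coarsely_in G (conjugate G g H) (g <# H)"
  unfolding coarsely_in_def
  by (rule exI[of _ "{g}"])
    (use assms in \<open>auto simp: conjugate_eq_image l_coset_def m_assoc subset_iff\<close>)

lemma coarsely_in_l_coset_iff_conjugate:
  assumes "H \<subseteq> carrier G" and "g \<in> carrier G"
  shows "coarsely_in G H (g <# H) \<longleftrightarrow> coarsely_in G H (conjugate G g H)"
    and "coarsely_in G (g <# H) H \<longleftrightarrow> coarsely_in G (conjugate G g H) H"
proof -
  have "g <# H \<subseteq> carrier G" "conjugate G g H \<subseteq> carrier G"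
    using assms by (auto simp: l_coset_def conjugate_eq_image)
  then show "coarsely_in G H (g <# H) \<longleftrightarrow> coarsely_in G H (conjugate G g H)"
    and "coarsely_in G (g <# H) H \<longleftrightarrow> coarsely_in G (conjugate G g H) H"
    using assms coarsely_in_trans coarsely_in_l_coset_conjugate coarsely_in_conjugate_l_coset
    by meson+
qed

section \<open>Finite index and the commensurator\<close>

lemma finite_index_iff_coarsely_in:
  assumes "subgroup H G" and "subgroup K G"
  shows "finite_index G (H \<inter> K) H \<longleftrightarrow> coarsely_in G H K" (is "?L \<longleftrightarrow> ?R")
proof -
  interpret H: subgroup H G by fact
  interpret K: subgroup K G by fact
  interpret HK: subgroup "H \<inter> K" G using assms by (rule subgroups_Inter_pair)
  \<comment> \<open>Restricting the carrier leaves the multiplication unchanged, so these are cosets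
    in \<open>G\<close> with representatives from \<open>H\<close>.\<close>
  have rc: "rcosets\<^bsub>G\<lparr>carrier := H\<rparr>\<^esub> (H \<inter> K) = (\<lambda>h. (H \<inter> K) #> h) ` H"
    by (auto simp: RCOSETS_def r_coset_def)
  show ?thesis
  proof
    assume ?L
    then obtain R where R: "R \<subseteq> H" "finite R"
      "(\<lambda>h. (H \<inter> K) #> h) ` H = (\<lambda>h. (H \<inter> K) #> h) ` R"
      unfolding finite_index_def rc by (metis finite_subset_image order_refl)
    \<comment> \<open>If \<open>r\<close> represents the coset of \<open>h\<close>, then
      \<open>h = k \<otimes> r\<close> with \<open>k\<close> in \<open>K\<close>, and translating by
      \<open>inv r\<close> leaves \<open>k\<close>.\<close>
    have "\<exists>f\<in>m_inv G ` R. h \<otimes> f \<in> K" if h: "h \<in> H" for h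
    proof -
      obtain r where r: "r \<in> R" "(H \<inter> K) #> h = (H \<inter> K) #> r" using R h by blast
      then have rG: "r \<in> carrier G" using R by auto
      have "h \<in> (H \<inter> K) #> r"
        using h r(2) rcos_self[of h "H \<inter> K"] HK.subgroup_axioms by auto
      then obtain k where k: "k \<in> K" "h = k \<otimes> r" by (auto simp: r_coset_def)
      then have "h \<otimes> inv r = k" using rG by (simp add: m_assoc)
      then show ?thesis using r k by blast
    qed
    then show ?R unfolding coarsely_in_def
      using R by (intro exI[of _ "m_inv G ` R"]) auto
  next
    assume ?R
    then obtain F where F: "finite F" "F \<subseteq> carrier G" "\<forall>h\<in>H. \<exists>f\<in>F. h \<otimes> f \<in> K"
      by (auto simp: coarsely_in_def)
    have same: "(H \<inter> K) #> h = (H \<inter> K) #> h'"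
      if "h \<in> H" "h' \<in> H" "f \<in> F" "h \<otimes> f \<in> K" "h' \<otimes> f \<in> K" for h h' f
    proof -
      have c: "h \<in> carrier G" "h' \<in> carrier G" "f \<in> carrier G" using that F by auto
      \<comment> \<open>The common translation \<open>f\<close> cancels in this quotient.\<close>
      have "(h \<otimes> f) \<otimes> inv (h' \<otimes> f) \<in> K" using that by blast
      also have "(h \<otimes> f) \<otimes> inv (h' \<otimes> f) = h \<otimes> inv h'"
        using c by (simp add: inv_mult_group m_assoc)
          (simp add: m_assoc[symmetric])
      finally have "h \<otimes> inv h' \<in> H \<inter> K" using that by blast
      moreover have "h = (h \<otimes> inv h') \<otimes> h'" using c by (simp add: m_assoc)
      ultimately have "h \<in> (H \<inter> K) #> h'" unfolding r_coset_def by blast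
      then show ?thesis
        using repr_independence c HK.subgroup_axioms by metis
    qed
    obtain t where t: "\<forall>h\<in>H. t h \<in> F \<and> h \<otimes> t h \<in> K" using F(3) by metis
    \<comment> \<open>Each \<open>f\<close> is sent to the coset of one chosen element of
      \<open>H\<close> that it moves into \<open>K\<close>; by \<open>same\<close> the choice does
      not affect the coset. Where no such element exists the value is arbitrary, which is harmless
      as only an inclusion is claimed.\<close>
    have "(\<lambda>h. (H \<inter> K) #> h) ` H \<subseteq>
      (\<lambda>f. (H \<inter> K) #> (SOME h. h \<in> H \<and> h \<otimes> f \<in> K)) ` F"
    proof (rule image_subsetI)
      fix h assume h: "h \<in> H"
      define h' where "h' = (SOME h'. h' \<in> H \<and> h' \<otimes> t h \<in> K)"
      have "h' \<in> H \<and> h' \<otimes> t h \<in> K"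
        unfolding h'_def by (rule someI[of _ h]) (use h t in auto)
      then have "(H \<inter> K) #> h = (H \<inter> K) #> h'" using same h t by blast
      then show "(H \<inter> K) #> h \<in> (\<lambda>f. (H \<inter> K) #> (SOME h. h \<in> H \<and> h \<otimes> f \<in> K)) ` F"
        using h t unfolding h'_def by blast
    qed
    then show ?L unfolding finite_index_def rc using F(1) finite_surj by blast
  qed
qed

text \<open>The two index conditions are \<open>finite_index_iff_coarsely_in\<close> for
  \<open>H\<close> and its conjugate, taken in both orders.\<close>

lemma commensurator_iff_coarsely_in:
  assumes "subgroup H G" and "g \<in> carrier G"
  shows "g \<in> commensurator G H \<longleftrightarrow>
    coarsely_in G H (conjugate G g H) \<and> coarsely_in G (conjugate G g H) H"
  using finite_index_iff_coarsely_in[OF assms(1) conjugate_subgroup[OF assms]]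
    finite_index_iff_coarsely_in[OF conjugate_subgroup[OF assms] assms(1)] assms(2)
  by (simp add: commensurator_def Int_commute)

end

theorem corollary5:
  fixes G :: "('a, 'b) monoid_scheme" and S :: "'a set"
  assumes "group G"
    and "finite S" and "S \<subseteq> carrier G" and "generate G S = carrier G"
  shows "(\<forall>H g. subgroup H G \<longrightarrow> g \<in> carrier G \<longrightarrow>
            (g \<in> commensurator G H \<longleftrightarrow> hausdorff_dist G S H (g <#\<^bsub>G\<^esub> H) < \<infinity>) \<and>
            (hausdorff_dist G S H (g <#\<^bsub>G\<^esub> H) < \<infinity> \<longleftrightarrow>
               hausdorff_dist G S H (conjugate G g H) < \<infinity>)) \<and>
         (\<forall>Q. subgroup Q G \<longrightarrow>
            (quasi_normal G Q \<longleftrightarrow>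
               (\<forall>g \<in> carrier G. hausdorff_dist G S Q (g <#\<^bsub>G\<^esub> Q) < \<infinity>)) \<and>
            ((\<forall>g \<in> carrier G. hausdorff_dist G S Q (g <#\<^bsub>G\<^esub> Q) < \<infinity>) \<longleftrightarrow>
               (\<forall>g \<in> carrier G. hausdorff_dist G S Q (conjugate G g Q) < \<infinity>)))"
proof -
  interpret group G by fact
  have conj: "g \<in> commensurator G H \<longleftrightarrow> hausdorff_dist G S H (conjugate G g H) < \<infinity>"
    and coset: "hausdorff_dist G S H (g <#\<^bsub>G\<^esub> H) < \<infinity> \<longleftrightarrow>
      hausdorff_dist G S H (conjugate G g H) < \<infinity>"
    if H: "subgroup H G" and g: "g \<in> carrier G" for H g
  proof -
    have sub: "H \<subseteq> carrier G" "conjugate G g H \<subseteq> carrier G" "g <#\<^bsub>G\<^esub> H \<subseteq> carrier G"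
      using subgroup.subset[OF H] subgroup.subset[OF conjugate_subgroup[OF H g]]
        l_coset_subset_G[OF _ g] by auto
    note finite_iff = hausdorff_dist_finite_iff_coarsely_in[OF assms(2-4) sub(1)]
    show "g \<in> commensurator G H \<longleftrightarrow> hausdorff_dist G S H (conjugate G g H) < \<infinity>"
      unfolding finite_iff[OF sub(2)] by (rule commensurator_iff_coarsely_in[OF H g])
    show "hausdorff_dist G S H (g <#\<^bsub>G\<^esub> H) < \<infinity> \<longleftrightarrow>
      hausdorff_dist G S H (conjugate G g H) < \<infinity>"
      unfolding finite_iff[OF sub(2)] finite_iff[OF sub(3)]
      using coarsely_in_l_coset_iff_conjugate[OF sub(1) g] by blast
  qed
  \<comment> \<open>The commensurator lies in the carrier by definition, so equality with it can be
    checked element by element.\<close>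
  have "quasi_normal G Q \<longleftrightarrow> (\<forall>g\<in>carrier G. g \<in> commensurator G Q)"
    if "subgroup Q G" for Q
    using that by (auto simp: quasi_normal_def commensurator_def)
  then show ?thesis using conj coset by simp
qed

end
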